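(* Let $P$ be a finite poset and let $u\in P^*$. Then the generating function $F(u)=\sum_{w\ge u} w\in\mathbb{Z}\langle\langle P\rangle\rangle$ is rational, where $\ge$ denotes generalized factor order on $P^*$.
   Context: $P^*$ is the free monoid of all finite words $w=w_1\cdots w_\ell$ over $P$ (including the empty word $\epsilon$), and $|w|$ is the length. A word $w'$ is a factor of $w$ if $w=uw'v$ for some words $u,v$. Generalized factor order on $P^*$: $u\le w$ if there is a factor $w'$ of $w$ with $|w'|=|u|$ and $u_i\le w'_i$ (in $P$) for $1\le i\le |u|$. $\mathbb{Z}\langle\langle P\rangle\rangle$ is the algebra of formal power series $\sum_{w\in P^*}c(w)w$ with integer coefficients in the noncommuting variables $P$. For $f$ with zero constant term, $f^*=\epsilon+f+f^2+\cdots=(\epsilon-f)^{-1}$. A series is rational if it can be built from the elements of $P$ using finitely many algebra operations and star operations. *)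

theory Defs
  imports "HOL-Library.Sublist"
begin

typedef 'a nc_series = "UNIV :: ('a list \<Rightarrow> int) set"
  morphisms nc_coeff Abs_nc_series ..

setup_lifting type_definition_nc_series

lemma nc_series_eqI: "(\<And>w. nc_coeff f w = nc_coeff g w) \<Longrightarrow> f = g"
  by (simp add: nc_coeff_inject[symmetric] ext)

instantiation nc_series :: (type) ring_1
begin

lift_definition zero_nc_series :: "'a nc_series" is "\<lambda>w. 0" .

lift_definition one_nc_series :: "'a nc_series" is "\<lambda>w. if w = [] then 1 else 0" .

lift_definition plus_nc_series :: "'a nc_series \<Rightarrow> 'a nc_series \<Rightarrow> 'a nc_series"
  is "\<lambda>f g w. f w + g w" .

lift_definition minus_nc_series :: "'a nc_series \<Rightarrow> 'a nc_series \<Rightarrow> 'a nc_series"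
  is "\<lambda>f g w. f w - g w" .

lift_definition uminus_nc_series :: "'a nc_series \<Rightarrow> 'a nc_series"
  is "\<lambda>f w. - f w" .

lift_definition times_nc_series :: "'a nc_series \<Rightarrow> 'a nc_series \<Rightarrow> 'a nc_series"
  is "\<lambda>f g w. \<Sum>i\<le>length w. f (take i w) * g (drop i w)" .

instance
proof
  fix f g h :: "'a nc_series"
  show "f * g * h = f * (g * h)"
  proof (rule nc_series_eqI)
    fix w :: "'a list"
    let ?n = "length w"
    let ?t = "\<lambda>j i. nc_coeff f (take j w) * nc_coeff g (drop j (take i w)) * nc_coeff h (drop i w)"
    have "nc_coeff (f * g * h) w = (\<Sum>i\<le>?n. \<Sum>j\<le>i. ?t j i)"
      by (auto simp: times_nc_series.rep_eq sum_distrib_right min_def intro!: sum.cong)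
    also have "\<dots> = (\<Sum>j\<le>?n. \<Sum>k\<le>?n - j. ?t j (j + k))"
      unfolding sum.Sigma[OF finite_atMost ballI[OF finite_atMost]]
      by (rule sum.reindex_bij_witness
            [where i = "\<lambda>(j, k). (j + k, j)" and j = "\<lambda>(i, j). (j, i - j)"]) auto
    also have "\<dots> = nc_coeff (f * (g * h)) w"
      by (auto simp: times_nc_series.rep_eq sum_distrib_left drop_take add.commute mult.assoc
               intro!: sum.cong)
    finally show "nc_coeff (f * g * h) w = nc_coeff (f * (g * h)) w" .
  qed
  show "1 * f = f"
  proof (rule nc_series_eqI)
    fix w
    have "nc_coeff (1 * f) w = (\<Sum>i\<le>length w. if i = 0 then nc_coeff f w else 0)"
      unfolding times_nc_series.rep_eq one_nc_series.rep_eq by (rule sum.cong) auto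
    then show "nc_coeff (1 * f) w = nc_coeff f w"
      by simp
  qed
  show "f * 1 = f"
  proof (rule nc_series_eqI)
    fix w
    have "nc_coeff (f * 1) w = (\<Sum>i\<le>length w. if i = length w then nc_coeff f w else 0)"
      unfolding times_nc_series.rep_eq one_nc_series.rep_eq by (rule sum.cong) auto
    then show "nc_coeff (f * 1) w = nc_coeff f w"
      by simp
  qed
  show "(0::'a nc_series) \<noteq> 1"
    by transfer (auto dest: fun_cong[where x = "[]"])
qed (transfer; force simp: algebra_simps sum.distrib)+

end

lift_definition letter :: "'a \<Rightarrow> 'a nc_series"
  is "\<lambda>a w. if w = [a] then 1 else 0" .

(* Formal infinite sum of the powers of f. The sum may be cut off at the length of the word
   because f has zero constant term, see nc_coeff_power_eq_0; the lemmas below confirm that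
   star f is the inverse of 1 - f. *)
definition star :: "'a nc_series \<Rightarrow> 'a nc_series"
  where "star f = Abs_nc_series (\<lambda>w. \<Sum>n\<le>length w. nc_coeff (f ^ n) w)"

lemma nc_coeff_star: "nc_coeff (star f) w = (\<Sum>n\<le>length w. nc_coeff (f ^ n) w)"
  by (simp add: star_def Abs_nc_series_inverse)

lemma nc_coeff_power_eq_0:
  assumes "nc_coeff f [] = 0" "length w < n"
  shows "nc_coeff (f ^ n) w = 0"
  using assms(2)
proof (induction n arbitrary: w)
  case (Suc n)
  have "nc_coeff f (take i w) * nc_coeff (f ^ n) (drop i w) = 0" if "i \<le> length w" for i
    using Suc assms(1) that by (cases "i = 0") auto
  then show ?case
    by (auto simp: times_nc_series.rep_eq intro!: sum.neutral)
qed simp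

lemma nc_coeff_star_cutoff:
  assumes "nc_coeff f [] = 0" "length w \<le> N"
  shows "nc_coeff (star f) w = (\<Sum>n\<le>N. nc_coeff (f ^ n) w)"
  unfolding nc_coeff_star
  by (rule sum.mono_neutral_left) (use assms in \<open>auto simp: nc_coeff_power_eq_0\<close>)

lemma nc_coeff_sum: "nc_coeff (sum f A) w = (\<Sum>x\<in>A. nc_coeff (f x) w)"
  by (induction A rule: infinite_finite_induct)
    (auto simp: zero_nc_series.rep_eq plus_nc_series.rep_eq)

lemma
  assumes "nc_coeff f [] = 0"
  shows one_minus_mult_star: "(1 - f) * star f = 1"
    and star_mult_one_minus: "star f * (1 - f) = 1"
proof -
  have telescope: "(1 - f) * (\<Sum>n\<le>N. f ^ n) = 1 - f ^ Suc N"
    "(\<Sum>n\<le>N. f ^ n) * (1 - f) = 1 - f ^ Suc N" for N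
  proof (induction N)
    case (Suc N)
    have "(1 - f) * f ^ Suc N = f ^ Suc N - f ^ Suc (Suc N)"
      "f ^ Suc N * (1 - f) = f ^ Suc N - f ^ Suc (Suc N)"
      by (simp_all add: left_diff_distrib right_diff_distrib power_commutes mult.assoc)
    then show "(1 - f) * (\<Sum>n\<le>Suc N. f ^ n) = 1 - f ^ Suc (Suc N)"
      "(\<Sum>n\<le>Suc N. f ^ n) * (1 - f) = 1 - f ^ Suc (Suc N)"
      using Suc by (simp_all only: sum.atMost_Suc distrib_left distrib_right) simp_all
  qed simp_all
  have star: "nc_coeff (star f) v = nc_coeff (\<Sum>n\<le>N. f ^ n) v" if "length v \<le> N" for v N
    using nc_coeff_star_cutoff[OF assms that] by (simp add: nc_coeff_sum)
  have "nc_coeff ((1 - f) * star f) w = nc_coeff ((1 - f) * (\<Sum>n\<le>length w. f ^ n)) w"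
    "nc_coeff (star f * (1 - f)) w = nc_coeff ((\<Sum>n\<le>length w. f ^ n) * (1 - f)) w" for w
    unfolding times_nc_series.rep_eq
    by (auto intro!: sum.cong simp: star[where N = "length w"])
  then show "(1 - f) * star f = 1" "star f * (1 - f) = 1"
    unfolding telescope
    by (auto intro!: nc_series_eqI
      simp: minus_nc_series.rep_eq nc_coeff_power_eq_0[OF assms] simp del: power_Suc)
qed

(* Multiplication by of_int c is multiplication by the integer scalar c.
   The zero series and negatives arise from the scalars 0 and -1. *)
inductive_set rational_series :: "'a set \<Rightarrow> 'a nc_series set" for P :: "'a set"
  where
    letter: "a \<in> P \<Longrightarrow> letter a \<in> rational_series P"
  | one: "1 \<in> rational_series P"
  | scalar: "f \<in> rational_series P \<Longrightarrow> of_int c * f \<in> rational_series P"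
  | add: "f \<in> rational_series P \<Longrightarrow> g \<in> rational_series P \<Longrightarrow> f + g \<in> rational_series P"
  | mult: "f \<in> rational_series P \<Longrightarrow> g \<in> rational_series P \<Longrightarrow> f * g \<in> rational_series P"
  | star: "f \<in> rational_series P \<Longrightarrow> nc_coeff f [] = 0 \<Longrightarrow> star f \<in> rational_series P"

(* Here r is the order relation of the poset, (a, b) \<in> r meaning that a is below b;
   list_all2 also requires equal lengths. *)
definition factor_le :: "('a \<times> 'a) set \<Rightarrow> 'a list \<Rightarrow> 'a list \<Rightarrow> bool"
  where "factor_le r u w \<longleftrightarrow>
    (\<exists>w'. sublist w' w \<and> list_all2 (\<lambda>a b. (a, b) \<in> r) u w')"

definition factor_series :: "'a set \<Rightarrow> ('a \<times> 'a) set \<Rightarrow> 'a list \<Rightarrow> 'a nc_series"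
  where "factor_series P r u =
    Abs_nc_series (\<lambda>w. if w \<in> lists P \<and> factor_le r u w then 1 else 0)"

end

(* The language of words above u has finitely many left quotients: each is determined by the
   set of suffixes of u that still remain to be matched by an occurrence begun in the letters
   already read. The characteristic series of these quotients satisfy a right-linear system
   with rational, proper coefficients. Eliminating one unknown at a time, by
   X = m X + c ==> X = star m * c, shows that every solution of such a system is rational. *)
theory Submission
  imports Defs
begin

lemma rational_series_0: "0 \<in> rational_series P"
  using rational_series.scalar[OF rational_series.one, of 0] by simp

lemma rational_series_sum:
  assumes "\<And>x. x \<in> A \<Longrightarrow> f x \<in> rational_series P"
  shows "sum f A \<in> rational_series P"
  using assms
  by (induction A rule: infinite_finite_induct)
    (auto intro: rational_series_0 rational_series.add)

lemma nc_coeff_mult_Nil: "nc_coeff (f * g) [] = nc_coeff f [] * nc_coeff g []"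
  by (simp add: times_nc_series.rep_eq)

lemma nc_coeff_letter_mult_Nil: "nc_coeff (letter a * g) [] = 0"
  by (simp add: nc_coeff_mult_Nil letter.rep_eq)

lemma nc_coeff_letter_mult_Cons:
  "nc_coeff (letter a * g) (b # w) = (if a = b then nc_coeff g w else 0)"
proof -
  \<comment> \<open>With the empty prefix split off, \<open>i\<close> counts the letters taken
    beyond \<open>b\<close>, so only the cut right after \<open>b\<close> survives.\<close>
  have tail: "(\<Sum>i\<le>length w. nc_coeff (letter a) (b # take i w) * nc_coeff g (drop i w))
      = (\<Sum>i\<le>length w. if i = 0 then if a = b then nc_coeff g w else 0 else 0)"
    by (rule sum.cong) (auto simp: letter.rep_eq)
  have "nc_coeff (letter a) [] = 0"
    by (simp add: letter.rep_eq)
  with tail show ?thesis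
    by (simp add: times_nc_series.rep_eq sum.atMost_Suc_shift del: sum.atMost_Suc)
qed

text \<open>As \<open>m\<close> has zero constant term, \<open>star m\<close> inverts
  \<open>1 - m\<close>, so \<open>(1 - m) * X = c\<close> can be solved for
  \<open>X\<close>.\<close>

lemma star_fixpoint_unique:
  assumes "nc_coeff m [] = 0" and "X = m * X + c"
  shows "X = star m * c"
proof -
  have "(1 - m) * X = c"
    using assms(2) by (metis add_diff_cancel_left' left_diff_distrib mult_1)
  then have "star m * c = (star m * (1 - m)) * X"
    by (simp add: mult.assoc)
  then show ?thesis
    by (simp add: star_mult_one_minus[OF assms(1)])
qed

text \<open>\<open>M\<close> and \<open>b\<close> change with each elimination while
  \<open>X\<close> stays fixed. The zero constant terms of \<open>M\<close> make each star
  legitimate and survive elimination.\<close>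

lemma rational_linear_system:
  assumes "finite Q"
    and "\<And>q p. q \<in> Q \<Longrightarrow> p \<in> Q \<Longrightarrow> M q p \<in> rational_series P"
    and "\<And>q p. q \<in> Q \<Longrightarrow> p \<in> Q \<Longrightarrow> nc_coeff (M q p) [] = 0"
    and "\<And>q. q \<in> Q \<Longrightarrow> b q \<in> rational_series P"
    and "\<And>q. q \<in> Q \<Longrightarrow> X q = (\<Sum>p\<in>Q. M q p * X p) + b q"
  shows "\<forall>q\<in>Q. X q \<in> rational_series P"
  using assms
proof (induction Q arbitrary: M b rule: finite_induct)
  case (insert z Q)
  define s where "s = star (M z z)"
  have s: "s \<in> rational_series P"
    unfolding s_def by (intro rational_series.star insert.prems) auto
  have Xz: "X z = s * ((\<Sum>p\<in>Q. M z p * X p) + b z)"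
    unfolding s_def
    by (rule star_fixpoint_unique)
      (use insert.hyps insert.prems(2,4)[of z] in \<open>simp_all add: add.assoc\<close>)
  \<comment> \<open>Substituting the solved form of \<open>X z\<close> into the equation for
    \<open>q\<close> yields these coefficients.\<close>
  define M' where "M' q p = M q p + M q z * s * M z p" for q p
  define b' where "b' q = b q + M q z * s * b z" for q
  have Q: "\<forall>q\<in>Q. X q \<in> rational_series P"
  proof (rule insert.IH[of M' b'])
    fix q assume q: "q \<in> Q"
    show "b' q \<in> rational_series P"
      unfolding b'_def using q s
      by (intro rational_series.add rational_series.mult insert.prems) auto
    have "X q = M q z * X z + (\<Sum>p\<in>Q. M q p * X p) + b q"
      using insert.prems(4)[of q] insert.hyps q by simp
    also have "M q z * X z = (\<Sum>p\<in>Q. M q z * s * M z p * X p) + M q z * s * b z"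
      by (subst Xz) (simp add: distrib_left sum_distrib_left mult.assoc)
    finally show "X q = (\<Sum>p\<in>Q. M' q p * X p) + b' q"
      by (simp add: M'_def b'_def distrib_right sum.distrib)
    fix p assume p: "p \<in> Q"
    show "M' q p \<in> rational_series P"
      unfolding M'_def using p q s
      by (intro rational_series.add rational_series.mult insert.prems) auto
    show "nc_coeff (M' q p) [] = 0"
      using p q insert.prems(2)
      by (simp add: M'_def plus_nc_series.rep_eq nc_coeff_mult_Nil)
  qed
  have "X z \<in> rational_series P"
    unfolding Xz using s Q
    by (intro rational_series.add rational_series.mult rational_series_sum insert.prems) auto
  with Q show ?case
    by simp
qed simp

text \<open>Generalizes \<open>factor_series\<close> to arbitrary languages, so that left quotients
  can be expressed.\<close>

definition char_series :: "'a set \<Rightarrow> 'a list set \<Rightarrow> 'a nc_series"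
  where "char_series P L = Abs_nc_series (\<lambda>w. if w \<in> lists P \<and> w \<in> L then 1 else 0)"

lemma nc_coeff_char_series:
  "nc_coeff (char_series P L) w = (if w \<in> lists P \<and> w \<in> L then 1 else 0)"
  by (simp add: char_series_def Abs_nc_series_inverse)

text \<open>A nonempty word has a unique first letter, and only the summand of that letter
  contributes to its coefficient.\<close>

lemma char_series_left_quotients:
  assumes "finite P"
  shows "char_series P L
    = (\<Sum>a\<in>P. letter a * char_series P {w. a # w \<in> L}) + (if [] \<in> L then 1 else 0)"
proof (rule nc_series_eqI)
  fix w
  show "nc_coeff (char_series P L) w = nc_coeff
    ((\<Sum>a\<in>P. letter a * char_series P {w. a # w \<in> L}) + (if [] \<in> L then 1 else 0)) w"
    using assms
    by (cases w) (auto simp: plus_nc_series.rep_eq nc_coeff_sum nc_coeff_letter_mult_Nil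
        nc_coeff_letter_mult_Cons nc_coeff_char_series one_nc_series.rep_eq zero_nc_series.rep_eq)
qed

text \<open>\<open>Q\<close> is the state set of a deterministic automaton whose transitions are
  left quotients; the linear system is read off from it.\<close>

lemma rational_char_series:
  assumes "finite P" and "finite Q"
    and quot: "\<And>L a. L \<in> Q \<Longrightarrow> a \<in> P \<Longrightarrow> {w. a # w \<in> L} \<in> Q"
    and "L \<in> Q"
  shows "char_series P L \<in> rational_series P"
proof -
  \<comment> \<open>The transition matrix: an entry sums the letters leading from \<open>L\<close>
    to \<open>K\<close>.\<close>
  define M where "M L K = (\<Sum>a\<in>{a \<in> P. {w. a # w \<in> L} = K}. letter a)" for L K :: "'a list set"
  have "\<forall>L\<in>Q. char_series P L \<in> rational_series P"
  proof (rule rational_linear_system[of Q M])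
    fix L assume L: "L \<in> Q"
    have "(\<Sum>K\<in>Q. M L K * char_series P K)
        = (\<Sum>K\<in>Q. \<Sum>a\<in>{a \<in> P. {w. a # w \<in> L} = K}. letter a * char_series P {w. a # w \<in> L})"
      unfolding M_def sum_distrib_right by (intro sum.cong) auto
    \<comment> \<open>Each letter leads from \<open>L\<close> to exactly one member of
      \<open>Q\<close>, so grouping by target counts it once.\<close>
    also have "\<dots> = (\<Sum>a\<in>P. letter a * char_series P {w. a # w \<in> L})"
      using assms L by (intro sum.group) auto
    finally show "char_series P L
        = (\<Sum>K\<in>Q. M L K * char_series P K) + (if [] \<in> L then 1 else 0)"
      by (simp add: char_series_left_quotients[OF \<open>finite P\<close>, of L])
    show "(if [] \<in> L then 1 else 0) \<in> rational_series P"
      by (simp add: rational_series_0 rational_series.one)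
    fix K
    show "M L K \<in> rational_series P"
      unfolding M_def by (intro rational_series_sum rational_series.letter) auto
    show "nc_coeff (M L K) [] = 0"
      by (simp add: M_def nc_coeff_sum letter.rep_eq)
  qed fact
  with \<open>L \<in> Q\<close> show ?thesis
    by blast
qed

definition prefix_le :: "('a \<times> 'a) set \<Rightarrow> 'a list \<Rightarrow> 'a list \<Rightarrow> bool"
  where "prefix_le r v w \<longleftrightarrow> (\<exists>w'. prefix w' w \<and> list_all2 (\<lambda>a b. (a, b) \<in> r) v w')"

lemma prefix_le_Cons:
  "prefix_le r v (a # w) \<longleftrightarrow> v = [] \<or> (\<exists>c v'. v = c # v' \<and> (c, a) \<in> r \<and> prefix_le r v' w)"
  unfolding prefix_le_def prefix_Cons by (cases v) (auto simp: list_all2_Cons1)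

lemma prefix_le_Nil: "prefix_le r [] w"
  by (simp add: prefix_le_def)

lemma factor_le_Cons: "factor_le r u (a # w) \<longleftrightarrow> prefix_le r u (a # w) \<or> factor_le r u w"
  unfolding factor_le_def prefix_le_def sublist_Cons_right by auto

lemma factor_le_Nil: "factor_le r [] w"
  by (auto simp: factor_le_def)

definition pending_lang :: "('a \<times> 'a) set \<Rightarrow> 'a list \<Rightarrow> 'a list set \<Rightarrow> 'a list set"
  where "pending_lang r u T = {w. factor_le r u w \<or> (\<exists>v\<in>T. prefix_le r v w)}"

text \<open>Reading \<open>a\<close> may begin a new occurrence, hence \<open>insert u T\<close>. A
  pending suffix loses its head if that lies below \<open>a\<close> and is dropped otherwise, except
  that \<open>[]\<close>, a completed occurrence, persists.\<close>

lemma pending_lang_left_quotient: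
  "{w. a # w \<in> pending_lang r u T}
    = pending_lang r u ({v. \<exists>c. c # v \<in> insert u T \<and> (c, a) \<in> r} \<union> (T \<inter> {[]}))"
  unfolding pending_lang_def mem_Collect_eq factor_le_Cons prefix_le_Cons
  \<comment> \<open>For \<open>u = []\<close> no head can be removed, but then both sides contain
    every word.\<close>
  by (cases "u = []") (auto simp: factor_le_Nil prefix_le_Nil)

theorem theorem1p1:
  fixes P :: "'a set" and r :: "('a \<times> 'a) set" and u :: "'a list"
  assumes "finite P" and "partial_order_on P r" and "u \<in> lists P"
  shows "factor_series P r u \<in> rational_series P"
proof -
  define Q where "Q = pending_lang r u ` Pow {v. suffix v u}"
  have "char_series P (pending_lang r u {}) \<in> rational_series P"
  proof (rule rational_char_series[OF \<open>finite P\<close>, of Q])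
    have "{v. suffix v u} = set (suffixes u)"
      by auto
    then show "finite Q"
      by (simp add: Q_def)
    show "pending_lang r u {} \<in> Q"
      by (simp add: Q_def)
    fix L a assume "L \<in> Q"
    then obtain T where T: "T \<subseteq> {v. suffix v u}" and L: "L = pending_lang r u T"
      by (auto simp: Q_def)
    \<comment> \<open>The tail of a suffix of \<open>u\<close> is again a suffix of
      \<open>u\<close>, so the states stay within \<open>Q\<close>.\<close>
    have "{v. \<exists>c. c # v \<in> insert u T \<and> (c, a) \<in> r} \<union> (T \<inter> {[]}) \<subseteq> {v. suffix v u}"
      using T by (auto dest: suffix_ConsD intro: suffix_ConsI)
    then show "{w. a # w \<in> L} \<in> Q"
      unfolding L pending_lang_left_quotient Q_def by blast
  qed
  \<comment> \<open>With nothing pending, the language consists of the words above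
    \<open>u\<close>.\<close>
  then show ?thesis
    by (simp add: char_series_def factor_series_def pending_lang_def)
qed

end
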